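(* Let $R$ be a dependency matrix for a spin system with $n$ sites, and let $\|\cdot\|$ be any matrix norm such that $\|R\|\le\mu<1$. Let $J_n=\|\mathbf J\|$, where $\mathbf J$ is the $n\times n$ all-ones matrix. Then the mixing time $\tau_{\mathrm r}(\varepsilon)$ of random update Glauber dynamics is asymptotically bounded by $$\hat\tau_{\mathrm r}(\varepsilon)\sim n(1-\mu)^{-1}\ln\big((1-\mu)^{-1}J_n/\varepsilon\big),$$ that is, for fixed $\varepsilon\in(0,1)$ and any sequence of such systems, one for each $n$ (with $R$, $\mu$ and the norm possibly depending on $n$), $$\limsup_{n\to\infty}\frac{\tau_{\mathrm r}(\varepsilon)}{n(1-\mu)^{-1}\ln\big((1-\mu)^{-1}J_n/\varepsilon\big)}\le 1 .$$
   Context: Spin system: the sites are $V=[n]=\{1,\dots,n\}$, the spins are a finite set $\Sigma=[q]$, and $\Omega^+=\Sigma^n$ is the set of configurations; $\pi$ is a probability distribution on $\Omega^+$. For a site $j$, $S_j$ is the set of pairs $(x,y)\in\Omega^+\times\Omega^+$ with $x_i=y_i$ for all $i\ne j$; $x\to^j c$ is the configuration that agrees with $x$ off $j$ and has spin $c$ at $j$. For each site $j$ there is a transition matrix $P^{[j]}$ on $\Omega^+$ such that $P^{[j]}(x,y)>0$ implies $(x,y)\in S_j$, and $\pi P^{[j]}=\pi$. Random update Glauber dynamics is the Markov chain on $\Omega^+$ with transition matrix $P^\dagger=\frac1n\sum_{j=1}^nP^{[j]}$. Dependency matrix: let $\mu_j(x,c)=P^{[j]}(x,x\to^j c)$, let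 $d_{\mathrm{TV}}$ be total variation distance, and let $\hat\varrho_{ij}=\max_{(x,y)\in S_i}d_{\mathrm{TV}}(\mu_j(x,\cdot),\mu_j(y,\cdot))$ be the influence of site $i$ on site $j$. A dependency matrix is any $n\times n$ matrix $R=(\varrho_{ij})$ with $\varrho_{ij}\ge\hat\varrho_{ij}$ for all $i,j$. Mixing time: $\tau(\varepsilon)$ is the least $t$ such that $d_{\mathrm{TV}}(x_t,\pi)\le\varepsilon$ for every initial configuration $x_0$, where $x_t$ is the (random) state after $t$ transitions. An asymptotic bound $\hat\tau(\varepsilon)$ is a quantity with $\limsup_{n\to\infty}\tau(\varepsilon)/\hat\tau(\varepsilon)\le1$. Matrix norm: a function $\|\cdot\|:\mathbb R^{m\times n}\to\mathbb R_{\ge 0}$ for all $m,n\in\mathbb N$ such that $\|R\|=0$ iff $R=\mathbf 0$; $\|cR\|=|c|\,\|R\|$ for $c\in\mathbb R$; $\|R+S\|\le\|R\|+\|S\|$; and $\|RS\|\le\|R\|\,\|S\|$ whenever the product is defined. *)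

theory Defs
  imports "HOL-Probability.Probability" "Jordan_Normal_Form.Matrix"
begin

text \<open>
  Sites are \<open>{..<n}\<close> and spins are \<open>{..<q}\<close>, numbered from 0 so that sites index matrices of
  type \<open>real mat\<close> directly. A transition matrix on the configurations is represented by its rows
  as a function into \<open>pmf\<close>: the entry at \<open>(x, y)\<close> is \<open>pmf (K x) y\<close>, and the product of a row
  vector \<open>p\<close> with the matrix is \<open>bind_pmf p K\<close>.
\<close>

type_synonym config = "nat \<Rightarrow> nat"

definition configs :: "nat \<Rightarrow> nat \<Rightarrow> config set" where
  "configs n q = {..<n} \<rightarrow>\<^sub>E {..<q}"

definition site_pairs :: "nat \<Rightarrow> nat \<Rightarrow> nat \<Rightarrow> (config \<times> config) set" where
  "site_pairs n q j =
     {(x, y). x \<in> configs n q \<and> y \<in> configs n q \<and> (\<forall>i<n. i \<noteq> j \<longrightarrow> x i = y i)}"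

locale spin_system =
  fixes n q :: nat
    and \<pi> :: "config pmf"
    and P :: "nat \<Rightarrow> config \<Rightarrow> config pmf"
  assumes support: "set_pmf \<pi> \<subseteq> configs n q"
    and local_update:
      "\<And>j x y. j < n \<Longrightarrow> x \<in> configs n q \<Longrightarrow> pmf (P j x) y > 0 \<Longrightarrow> (x, y) \<in> site_pairs n q j"
    and stationary: "\<And>j. j < n \<Longrightarrow> bind_pmf \<pi> (P j) = \<pi>"

definition random_update :: "nat \<Rightarrow> (nat \<Rightarrow> config \<Rightarrow> config pmf) \<Rightarrow> config \<Rightarrow> config pmf" where
  "random_update n P x = bind_pmf (pmf_of_set {..<n}) (\<lambda>j. P j x)"

lemma pmf_random_update:
  assumes "n \<ge> 1"
  shows "pmf (random_update n P x) y = 1 / real n * (\<Sum>j<n. pmf (P j x) y)"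
  using assms by (auto simp: random_update_def pmf_bind integral_pmf_of_set lessThan_empty_iff)

text \<open>Total variation distance of two probability mass functions carried by the finite set \<open>A\<close>.\<close>

definition d_TV :: "'a set \<Rightarrow> ('a \<Rightarrow> real) \<Rightarrow> ('a \<Rightarrow> real) \<Rightarrow> real" where
  "d_TV A f g = (\<Sum>a\<in>A. \<bar>f a - g a\<bar>) / 2"

definition update_dist :: "(nat \<Rightarrow> config \<Rightarrow> config pmf) \<Rightarrow> nat \<Rightarrow> config \<Rightarrow> nat \<Rightarrow> real" where
  "update_dist P j x c = pmf (P j x) (x(j := c))"

definition influence ::
    "nat \<Rightarrow> nat \<Rightarrow> (nat \<Rightarrow> config \<Rightarrow> config pmf) \<Rightarrow> nat \<Rightarrow> nat \<Rightarrow> real" where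
  "influence n q P i j =
     Max ((\<lambda>(x, y). d_TV {..<q} (update_dist P j x) (update_dist P j y)) ` site_pairs n q i)"

definition dependency_matrix ::
    "nat \<Rightarrow> nat \<Rightarrow> (nat \<Rightarrow> config \<Rightarrow> config pmf) \<Rightarrow> real mat \<Rightarrow> bool" where
  "dependency_matrix n q P R \<longleftrightarrow>
     R \<in> carrier_mat n n \<and> (\<forall>i<n. \<forall>j<n. influence n q P i j \<le> R $$ (i, j))"

primrec state_dist :: "(config \<Rightarrow> config pmf) \<Rightarrow> config \<Rightarrow> nat \<Rightarrow> config pmf" where
  "state_dist K x 0 = return_pmf x"
| "state_dist K x (Suc t) = bind_pmf (state_dist K x t) K"

text \<open>
  In \<open>enat\<close> the infimum of a nonempty set is its least element; the value is \<open>\<infinity>\<close> if no \<open>t\<close> has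
  the required property.
\<close>

definition mixing_time ::
    "config set \<Rightarrow> config pmf \<Rightarrow> (config \<Rightarrow> config pmf) \<Rightarrow> real \<Rightarrow> enat" where
  "mixing_time \<Omega> \<pi> K \<epsilon> =
     (INF t\<in>{t. \<forall>x\<in>\<Omega>. d_TV \<Omega> (pmf (state_dist K x t)) (pmf \<pi>) \<le> \<epsilon>}. enat t)"

definition matrix_norm :: "(real mat \<Rightarrow> real) \<Rightarrow> bool" where
  "matrix_norm N \<longleftrightarrow>
     (\<forall>A. N A \<ge> 0) \<and>
     (\<forall>A. N A = 0 \<longleftrightarrow> A = 0\<^sub>m (dim_row A) (dim_col A)) \<and>
     (\<forall>c A. N (c \<cdot>\<^sub>m A) = \<bar>c\<bar> * N A) \<and>
     (\<forall>A B. dim_row A = dim_row B \<and> dim_col A = dim_col B \<longrightarrow> N (A + B) \<le> N A + N B) \<and>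
     (\<forall>A B. dim_col A = dim_row B \<longrightarrow> N (A * B) \<le> N A * N B)"

definition all_ones :: "nat \<Rightarrow> real mat" where
  "all_ones n = Matrix.mat n n (\<lambda>_. 1)"

end

theory Submission
  imports Defs
begin

text \<open>
  The proof follows Dobrushin's method of oscillations. Instead of coupling two copies of the
  chain, it tracks how its transition operator acts on test functions. Say that a function \<open>f\<close>
  on configurations has oscillation at most \<open>w i\<close> at site \<open>i\<close> if changing the spin at \<open>i\<close> alone
  changes \<open>f\<close> by at most \<open>w i\<close>. Averaging \<open>f\<close> over an update of site \<open>j\<close> removes the direct
  dependence on the spin at \<open>j\<close>, but each site \<open>i\<close> influences the distribution of the new spin,
  which costs at most \<open>R $$ (i, j) * w j\<close> (\<open>osc_update\<close>). Averaging over \<open>j\<close>, one step of random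
  update dynamics replaces the vector \<open>w\<close> by \<open>M w\<close>, where \<open>M = (1 - 1/n) I + R/n\<close>
  (\<open>osc_random_update\<close>).

  An indicator function has oscillation at most 1 at every site, and two values of a function
  differ by at most the sum of its oscillations over all sites. As \<open>\<pi>\<close> is stationary, the distance
  from \<open>\<pi>\<close> after \<open>t\<close> steps is therefore at most \<open>s = 1\<^sup>T M\<^sup>t 1\<close> (\<open>d_TV_state_dist_le\<close>).

  With \<open>J\<close> the all-ones matrix and \<open>r = 1 - (1 - \<mu>)/n\<close>, induction on \<open>t\<close> gives
  \<open>\<parallel>M\<^sup>t J\<parallel> \<le> r\<^sup>t \<parallel>J\<parallel>\<close>. Since \<open>J M\<^sup>t J = s J\<close>, submultiplicativity gives \<open>s \<le> r\<^sup>t \<parallel>J\<parallel>\<close>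
  (\<open>sum_dobrushin_step_le\<close>). The norm of the identity matrix, which may exceed 1, never enters.
  Because \<open>r \<le> exp (- (1 - \<mu>)/n)\<close>, the distance is at most \<open>\<epsilon>\<close> as soon as
  \<open>t \<ge> n (1 - \<mu>)\<^sup>-\<^sup>1 ln (\<parallel>J\<parallel>/\<epsilon>)\<close> (\<open>mixing_time_le\<close>). As \<open>\<mu> \<ge> 0\<close>, the
  further factor \<open>(1 - \<mu>)\<^sup>-\<^sup>1\<close> inside the logarithm of the claimed bound only increases it.
  Rounding \<open>t\<close> up to an integer adds less than 1, which is negligible against a bound of order at least \<open>n ln (1/\<epsilon>)\<close>.
\<close>


section \<open>Total variation distance and test functions\<close>

text \<open>The total variation distance is the difference of the measures of one particular event.\<close>

lemma d_TV_attained_on_subset: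
  assumes "sum f A = sum g A"
  shows "d_TV A f g = (\<Sum>a\<in>A. (f a - g a) * indicator {a. g a < f a} a)"
proof -
  have "2 * (\<Sum>a\<in>A. (f a - g a) * indicator {a. g a < f a} a) =
      (\<Sum>a\<in>A. \<bar>f a - g a\<bar> + (f a - g a))"
    unfolding sum_distrib_left by (rule sum.cong) (auto simp: indicator_def)
  also have "\<dots> = (\<Sum>a\<in>A. \<bar>f a - g a\<bar>)"
    using assms by (simp add: sum.distrib sum_subtractf)
  finally show ?thesis by (simp add: d_TV_def)
qed

lemma abs_sum_diff_le_d_TV:
  fixes f g h :: "'a \<Rightarrow> real"
  assumes "finite A" and "sum f A = sum g A"
    and osc: "\<And>a b. a \<in> A \<Longrightarrow> b \<in> A \<Longrightarrow> \<bar>h a - h b\<bar> \<le> w"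
  shows "\<bar>(\<Sum>a\<in>A. (f a - g a) * h a)\<bar> \<le> d_TV A f g * w"
proof (cases "A = {}")
  case True
  then show ?thesis by (simp add: d_TV_def)
next
  case False
  \<comment> \<open>Subtracting a constant from \<open>h\<close> does not change the sum; the midrange of \<open>h\<close> gains the
    factor \<open>1/2\<close>.\<close>
  define m where "m = (Max (h ` A) + Min (h ` A)) / 2"
  have fin: "finite (h ` A)" "h ` A \<noteq> {}" using assms(1) False by auto
  obtain a b where ab: "a \<in> A" "b \<in> A" "Max (h ` A) = h a" "Min (h ` A) = h b"
    using Max_in[OF fin] Min_in[OF fin] by auto
  have mid: "\<bar>h c - m\<bar> \<le> w / 2" if "c \<in> A" for c
  proof -
    have "h c \<le> h a" "h b \<le> h c"
      using ab that fin Max_ge[OF fin(1), of "h c"] Min_le[OF fin(1), of "h c"] by auto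
    moreover have "h a - h b \<le> w" using osc[OF ab(1,2)] by simp
    ultimately show ?thesis unfolding m_def ab by (auto simp: abs_le_iff field_simps)
  qed
  have "(\<Sum>a\<in>A. (f a - g a) * h a) = (\<Sum>a\<in>A. (f a - g a) * (h a - m))"
    using assms(2) by (simp add: right_diff_distrib sum_subtractf flip: sum_distrib_right)
  also have "\<bar>\<dots>\<bar> \<le> (\<Sum>a\<in>A. \<bar>f a - g a\<bar> * (w / 2))"
    by (rule order_trans[OF sum_abs sum_mono]) (simp only: abs_mult mult_left_mono[OF mid abs_ge_zero])
  also have "\<dots> = d_TV A f g * w" by (simp add: d_TV_def flip: sum_distrib_right sum_divide_distrib)
  finally show ?thesis .
qed


section \<open>Oscillations of functions on configurations\<close>

lemma finite_configs [simp]: "finite (configs n q)"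
  by (simp add: configs_def finite_PiE)

lemma site_pairsD:
  assumes "(x, y) \<in> site_pairs n q i"
  shows "x \<in> configs n q" "y \<in> configs n q" "x(i := y i) = y"
proof -
  show x: "x \<in> configs n q" and y: "y \<in> configs n q"
    using assms by (auto simp: site_pairs_def)
  have "x k = y k" if "k \<noteq> i" for k
    using assms that x y by (cases "k < n") (auto simp: site_pairs_def configs_def PiE_def extensional_def)
  then show "x(i := y i) = y" by auto
qed

lemma configs_upd: "x \<in> configs n q \<Longrightarrow> j < n \<Longrightarrow> c < q \<Longrightarrow> x(j := c) \<in> configs n q"
  by (auto simp: configs_def PiE_def extensional_def)

text \<open>
  \<open>w\<close> bounds the oscillations of \<open>f\<close>: changing the spin at site \<open>i\<close> changes \<open>f\<close> by at most \<open>w i\<close>.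
\<close>

definition osc_bounded :: "nat \<Rightarrow> nat \<Rightarrow> (config \<Rightarrow> real) \<Rightarrow> (nat \<Rightarrow> real) \<Rightarrow> bool" where
  "osc_bounded n q f w \<longleftrightarrow> (\<forall>i<n. \<forall>(x, y) \<in> site_pairs n q i. \<bar>f x - f y\<bar> \<le> w i)"

lemma osc_boundedD:
  "osc_bounded n q f w \<Longrightarrow> i < n \<Longrightarrow> (x, y) \<in> site_pairs n q i \<Longrightarrow> \<bar>f x - f y\<bar> \<le> w i"
  by (auto simp: osc_bounded_def)

lemma osc_bounded_nonneg:
  assumes "osc_bounded n q f w" "x \<in> configs n q" "i < n"
  shows "0 \<le> w i"
  using osc_boundedD[OF assms(1,3), of x x] assms(2) by (simp add: site_pairs_def)

lemma osc_bounded_diff_le: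
  assumes osc: "osc_bounded n q f w" and x: "x \<in> configs n q" and y: "y \<in> configs n q"
  shows "\<bar>f x - f y\<bar> \<le> (\<Sum>i<n. w i)"
proof -
  \<comment> \<open>The configurations \<open>z k\<close> turn \<open>x\<close> into \<open>y\<close> one site at a time.\<close>
  define z where "z k = (\<lambda>i. if i < k then y i else x i)" for k
  have pair: "(z k, z (Suc k)) \<in> site_pairs n q k" if "k < n" for k
    using x y that by (auto simp: site_pairs_def z_def configs_def PiE_def extensional_def)
  have "\<bar>f (z 0) - f (z k)\<bar> \<le> (\<Sum>i<k. w i)" if "k \<le> n" for k
    using that
  proof (induction k)
    case (Suc k)
    then show ?case using osc_boundedD[OF osc _ pair, of k] by simp
  qed simp
  moreover have "z 0 = x" "z n = y"
    using x y by (auto simp: z_def configs_def PiE_def extensional_def)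
  ultimately show ?thesis by (metis order_refl)
qed


section \<open>One step of the Glauber dynamics\<close>

lemma influence_ge:
  assumes "(x, y) \<in> site_pairs n q i"
  shows "d_TV {..<q} (update_dist P j x) (update_dist P j y) \<le> influence n q P i j"
proof -
  have "site_pairs n q i \<subseteq> configs n q \<times> configs n q" by (auto simp: site_pairs_def)
  then have "finite (site_pairs n q i)" by (rule finite_subset) simp
  then show ?thesis unfolding influence_def
    by (intro Max_ge) (use assms in force)+
qed

text \<open>
  The action of the matrix \<open>(1 - 1/n) I + R/n\<close> on a column vector with entries \<open>w i\<close>, \<open>i < n\<close>.
\<close>

definition dobrushin_step :: "nat \<Rightarrow> real mat \<Rightarrow> (nat \<Rightarrow> real) \<Rightarrow> nat \<Rightarrow> real" where
  "dobrushin_step n R w i = (1 - 1 / real n) * w i + (1 / real n) * (\<Sum>j<n. R $$ (i, j) * w j)"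

context spin_system
begin

lemma set_update_subset:
  assumes "j < n" "x \<in> configs n q"
  shows "set_pmf (P j x) \<subseteq> (\<lambda>c. x(j := c)) ` {..<q}"
proof
  fix y assume "y \<in> set_pmf (P j x)"
  then have "(x, y) \<in> site_pairs n q j"
    using local_update[OF assms] by (simp add: pmf_positive)
  note y = site_pairsD[OF this]
  have "y j < q" using y(2) assms(1) by (auto simp: configs_def PiE_def)
  then show "y \<in> (\<lambda>c. x(j := c)) ` {..<q}" using y(3) by (intro image_eqI[of _ _ "y j"]) simp_all
qed

lemma expectation_update:
  fixes f :: "config \<Rightarrow> real"
  assumes "j < n" "x \<in> configs n q"
  shows "measure_pmf.expectation (P j x) f = (\<Sum>c<q. update_dist P j x c * f (x(j := c)))"
proof -
  have inj: "inj_on (\<lambda>c. x(j := c)) {..<q}" by (rule inj_onI) (metis fun_upd_same)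
  have "measure_pmf.expectation (P j x) f = (\<Sum>y\<in>(\<lambda>c. x(j := c)) ` {..<q}. f y * pmf (P j x) y)"
    using set_update_subset[OF assms] by (intro integral_measure_pmf_real) auto
  also have "\<dots> = (\<Sum>c<q. update_dist P j x c * f (x(j := c)))"
    by (simp add: sum.reindex[OF inj] update_dist_def mult.commute)
  finally show ?thesis .
qed

lemma sum_update_dist:
  assumes "j < n" "x \<in> configs n q"
  shows "(\<Sum>c<q. update_dist P j x c) = 1"
  using expectation_update[OF assms, of "\<lambda>_. 1"] by simp

text \<open>
  The effect on the expectation of \<open>f\<close> of changing the spin at \<open>i\<close> before an update of site \<open>j\<close>
  is the sum of two contributions: \<open>A\<close>, in which the new spin at \<open>j\<close> has the same distribution
  and only the configuration around it differs, and \<open>B\<close>, in which the distribution of the new spin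
  differs. For \<open>i = j\<close> the update erases the change, so \<open>A\<close> vanishes.
\<close>

lemma osc_update:
  assumes R: "dependency_matrix n q P R" and osc: "osc_bounded n q f w"
    and i: "i < n" and j: "j < n" and xy: "(x, y) \<in> site_pairs n q i"
  shows "\<bar>measure_pmf.expectation (P j x) f - measure_pmf.expectation (P j y) f\<bar>
    \<le> (if i = j then 0 else w i) + R $$ (i, j) * w j"
proof -
  note [simp] = site_pairsD(1,2)[OF xy]
  let ?p = "update_dist P j x" and ?p' = "update_dist P j y"
  define A where "A = (\<Sum>c<q. ?p c * (f (x(j := c)) - f (y(j := c))))"
  define B where "B = (\<Sum>c<q. (?p c - ?p' c) * f (y(j := c)))"
  have split: "measure_pmf.expectation (P j x) f - measure_pmf.expectation (P j y) f = A + B"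
    unfolding A_def B_def using j
    by (simp add: expectation_update algebra_simps flip: sum_subtractf sum.distrib)
  have "\<bar>A\<bar> \<le> (if i = j then 0 else w i)"
  proof (cases "i = j")
    case True
    have "x(j := c) = y(j := c)" for c using site_pairsD(3)[OF xy] True by (metis fun_upd_upd)
    then show ?thesis using True by (simp add: A_def)
  next
    case False
    have "\<bar>A\<bar> \<le> (\<Sum>c<q. ?p c * w i)"
      unfolding A_def
    proof (rule order_trans[OF sum_abs sum_mono])
      fix c assume c: "c \<in> {..<q}"
      have "(x(j := c), y(j := c)) \<in> site_pairs n q i"
        using xy c j by (auto simp: site_pairs_def configs_upd)
      then show "\<bar>?p c * (f (x(j := c)) - f (y(j := c)))\<bar> \<le> ?p c * w i"
        using osc_boundedD[OF osc i] by (auto simp: abs_mult update_dist_def intro: mult_left_mono)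
    qed
    also have "\<dots> = w i" using j by (simp add: sum_update_dist flip: sum_distrib_right)
    finally show ?thesis using False by simp
  qed
  moreover have "\<bar>B\<bar> \<le> R $$ (i, j) * w j"
  proof -
    have "\<bar>B\<bar> \<le> d_TV {..<q} ?p ?p' * w j"
      unfolding B_def
    proof (rule abs_sum_diff_le_d_TV)
      show "\<bar>f (y(j := a)) - f (y(j := b))\<bar> \<le> w j" if "a \<in> {..<q}" "b \<in> {..<q}" for a b
        by (rule osc_boundedD[OF osc j]) (use that j in \<open>auto simp: site_pairs_def configs_upd\<close>)
    qed (use j in \<open>auto simp: sum_update_dist\<close>)
    also have "\<dots> \<le> R $$ (i, j) * w j"
    proof (rule mult_right_mono)
      show "d_TV {..<q} ?p ?p' \<le> R $$ (i, j)"
        using influence_ge[OF xy] R i j unfolding dependency_matrix_def by (meson order_trans)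
      show "0 \<le> w j" by (rule osc_bounded_nonneg[OF osc _ j, of x]) simp
    qed
    finally show ?thesis .
  qed
  ultimately show ?thesis unfolding split by linarith
qed

lemma set_random_update_subset:
  assumes "n \<ge> 1" "x \<in> configs n q"
  shows "set_pmf (random_update n P x) \<subseteq> configs n q"
proof -
  have "set_pmf (P j x) \<subseteq> configs n q" if "j < n" for j
    using set_update_subset[OF that assms(2)] configs_upd[OF assms(2) that] by blast
  then show ?thesis using assms(1) by (auto simp: random_update_def lessThan_empty_iff)
qed

lemma expectation_random_update:
  fixes f :: "config \<Rightarrow> real"
  assumes "n \<ge> 1" "x \<in> configs n q"
  shows "measure_pmf.expectation (random_update n P x) f
    = 1 / real n * (\<Sum>j<n. measure_pmf.expectation (P j x) f)"
proof -
  have "measure_pmf.expectation (random_update n P x) f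
    = (\<Sum>j<n. measure_pmf.expectation (P j x) f /\<^sub>R real (card {..<n}))"
    unfolding random_update_def
  proof (rule pmf_expectation_bind_pmf_of_set)
    show "finite (set_pmf (P j x))" if "j \<in> {..<n}" for j
      using that assms(2) finite_subset[OF set_update_subset] by auto
  qed (use assms(1) in \<open>auto simp: lessThan_empty_iff\<close>)
  then show ?thesis by (simp add: sum_divide_distrib divide_inverse sum_distrib_left)
qed

lemma osc_random_update:
  assumes n: "n \<ge> 1" and R: "dependency_matrix n q P R" and osc: "osc_bounded n q f w"
  shows "osc_bounded n q (\<lambda>x. measure_pmf.expectation (random_update n P x) f)
    (dobrushin_step n R w)"
  unfolding osc_bounded_def
proof safe
  fix i x y assume i: "i < n" and xy: "(x, y) \<in> site_pairs n q i"
  note [simp] = site_pairsD(1,2)[OF xy]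
  let ?E = "\<lambda>j x. measure_pmf.expectation (P j x) f"
  have "\<bar>(\<Sum>j<n. ?E j x - ?E j y)\<bar> \<le> (\<Sum>j<n. (if i = j then 0 else w i) + R $$ (i, j) * w j)"
    by (rule order_trans[OF sum_abs sum_mono]) (use osc_update[OF R osc i _ xy] in auto)
  also have "\<dots> = (\<Sum>j<n. w i - (if i = j then w i else 0)) + (\<Sum>j<n. R $$ (i, j) * w j)"
    unfolding sum.distrib by (intro arg_cong2[where f = "(+)"] sum.cong) auto
  also have "\<dots> = (real n - 1) * w i + (\<Sum>j<n. R $$ (i, j) * w j)"
    using i by (simp add: sum_subtractf algebra_simps)
  finally have "1 / real n * \<bar>(\<Sum>j<n. ?E j x - ?E j y)\<bar>
    \<le> 1 / real n * ((real n - 1) * w i + (\<Sum>j<n. R $$ (i, j) * w j))"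
    by (rule mult_left_mono) simp
  also have "\<dots> = dobrushin_step n R w i"
    using n by (simp add: dobrushin_step_def field_simps)
  finally show "\<bar>measure_pmf.expectation (random_update n P x) f
      - measure_pmf.expectation (random_update n P y) f\<bar> \<le> dobrushin_step n R w i"
    using n by (simp add: expectation_random_update sum_subtractf abs_divide flip: diff_divide_distrib)
qed


section \<open>Convergence to the stationary distribution\<close>

lemma set_state_dist_subset:
  assumes "n \<ge> 1" "x \<in> configs n q"
  shows "set_pmf (state_dist (random_update n P) x t) \<subseteq> configs n q"
proof (induction t)
  case (Suc t)
  then show ?case using set_random_update_subset[OF assms(1)] by (simp add: UN_least subset_iff) blast
qed (use assms(2) in simp)

text \<open>
  Splitting off the first transition instead of the last lets induction on \<open>t\<close> apply the one-step
  bound to the function obtained after \<open>t\<close> steps.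
\<close>

lemma state_dist_Suc_left:
  "state_dist K x (Suc t) = bind_pmf (K x) (\<lambda>y. state_dist K y t)"
  by (induction t) (simp_all add: bind_return_pmf bind_return_pmf' bind_assoc_pmf)

lemma osc_state_dist:
  assumes n: "n \<ge> 1" and R: "dependency_matrix n q P R" and osc: "osc_bounded n q f w"
  shows "osc_bounded n q (\<lambda>x. measure_pmf.expectation (state_dist (random_update n P) x t) f)
    ((dobrushin_step n R ^^ t) w)"
proof (induction t)
  case 0
  then show ?case using osc by simp
next
  case (Suc t)
  let ?K = "random_update n P"
  have "measure_pmf.expectation (state_dist ?K x (Suc t)) f =
      measure_pmf.expectation (?K x) (\<lambda>y. measure_pmf.expectation (state_dist ?K y t) f)"
    if x: "x \<in> configs n q" for x
  proof -
    note sub = set_random_update_subset[OF n x]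
    have "measure_pmf.expectation (state_dist ?K x (Suc t)) f =
      (\<Sum>y\<in>configs n q. pmf (?K x) y *\<^sub>R measure_pmf.expectation (state_dist ?K y t) f)"
      unfolding state_dist_Suc_left
      by (rule pmf_expectation_bind)
        (use sub finite_subset[OF set_state_dist_subset[OF n]] in auto)
    also have "\<dots> = measure_pmf.expectation (?K x)
        (\<lambda>y. measure_pmf.expectation (state_dist ?K y t) f)"
      by (subst integral_measure_pmf_real[of "configs n q"]) (use sub in \<open>auto simp: mult.commute\<close>)
    finally show ?thesis .
  qed
  then show ?case
    using osc_random_update[OF n R Suc.IH]
    by (auto simp: osc_bounded_def site_pairs_def simp del: state_dist.simps)
qed

lemma stationary_random_update:
  assumes "n \<ge> 1"
  shows "bind_pmf \<pi> (random_update n P) = \<pi>"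
proof -
  have "bind_pmf \<pi> (random_update n P) = bind_pmf (pmf_of_set {..<n}) (\<lambda>j. bind_pmf \<pi> (P j))"
    unfolding random_update_def by (rule bind_commute_pmf)
  also have "\<dots> = bind_pmf (pmf_of_set {..<n}) (\<lambda>j. \<pi>)"
    by (rule bind_pmf_cong) (use assms stationary in \<open>auto simp: lessThan_empty_iff\<close>)
  finally show ?thesis by simp
qed

lemma stationary_state_dist:
  assumes "n \<ge> 1"
  shows "bind_pmf \<pi> (\<lambda>x. state_dist (random_update n P) x t) = \<pi>"
  by (induction t) (simp_all add: bind_return_pmf' stationary_random_update[OF assms]
      flip: bind_assoc_pmf)

lemma d_TV_state_dist_le:
  assumes n: "n \<ge> 1" and R: "dependency_matrix n q P R" and x: "x \<in> configs n q"
  shows "d_TV (configs n q) (pmf (state_dist (random_update n P) x t)) (pmf \<pi>)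
    \<le> (\<Sum>i<n. (dobrushin_step n R ^^ t) (\<lambda>_. 1) i)"
proof -
  let ?\<Omega> = "configs n q"
  let ?D = "\<lambda>x. state_dist (random_update n P) x t"
  define A where "A = {y. pmf \<pi> y < pmf (?D x) y}"
  define F where "F = (\<lambda>y. measure_pmf.expectation (?D y) (indicator A :: config \<Rightarrow> real))"
  let ?s = "\<Sum>i<n. (dobrushin_step n R ^^ t) (\<lambda>_. 1) i"
  have "osc_bounded n q (indicator A) (\<lambda>_. 1)" by (auto simp: osc_bounded_def indicator_def)
  then have oscF: "osc_bounded n q F ((dobrushin_step n R ^^ t) (\<lambda>_. 1))"
    unfolding F_def by (rule osc_state_dist[OF n R])
  have sum1: "sum (pmf p) ?\<Omega> = 1" if "set_pmf p \<subseteq> ?\<Omega>" for p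
    using that by (intro sum_pmf_eq_1) auto
  have Fx: "F x = (\<Sum>y\<in>?\<Omega>. pmf (?D x) y * indicator A y)"
    unfolding F_def by (subst integral_measure_pmf_real[of ?\<Omega>])
      (use set_state_dist_subset[OF n x] in \<open>auto simp: mult.commute\<close>)
  have "(\<Sum>y\<in>?\<Omega>. pmf \<pi> y * indicator A y) = measure_pmf.expectation \<pi> (indicator A)"
    by (subst integral_measure_pmf_real[of ?\<Omega>]) (use support in \<open>auto simp: mult.commute\<close>)
  also have "\<dots> = measure_pmf.expectation (bind_pmf \<pi> ?D) (indicator A)"
    by (simp add: stationary_state_dist[OF n])
  also have "\<dots> = (\<Sum>y\<in>?\<Omega>. pmf \<pi> y *\<^sub>R F y)"
    unfolding F_def by (rule pmf_expectation_bind)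
      (use support finite_subset[OF set_state_dist_subset[OF n]] in auto)
  finally have F\<pi>: "(\<Sum>y\<in>?\<Omega>. pmf \<pi> y * indicator A y) = (\<Sum>y\<in>?\<Omega>. pmf \<pi> y * F y)" by simp
  have "d_TV ?\<Omega> (pmf (?D x)) (pmf \<pi>) = (\<Sum>y\<in>?\<Omega>. (pmf (?D x) y - pmf \<pi> y) * indicator A y)"
    unfolding A_def by (rule d_TV_attained_on_subset)
      (simp_all add: sum1 support set_state_dist_subset[OF n x])
  also have "\<dots> = F x - (\<Sum>y\<in>?\<Omega>. pmf \<pi> y * F y)"
    by (simp add: left_diff_distrib sum_subtractf Fx F\<pi>)
  also have "\<dots> = (\<Sum>y\<in>?\<Omega>. pmf \<pi> y * (F x - F y))"
    by (simp add: right_diff_distrib sum_subtractf sum1[OF support] flip: sum_distrib_right)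
  also have "\<dots> \<le> (\<Sum>y\<in>?\<Omega>. pmf \<pi> y * ?s)"
    using osc_bounded_diff_le[OF oscF x] by (intro sum_mono mult_left_mono) (auto simp: abs_le_iff)
  also have "\<dots> = ?s" by (simp add: sum1[OF support] flip: sum_distrib_right)
  finally show ?thesis .
qed

end


section \<open>Decay of the oscillations in a matrix norm\<close>

lemma matrix_norm_all_ones_ge:
  assumes N: "matrix_norm N" and n: "n \<ge> 1"
  shows "1 \<le> N (all_ones n)"
proof -
  let ?J = "all_ones n"
  have "?J * ?J = real n \<cdot>\<^sub>m ?J"
    by (rule eq_matI) (auto simp: all_ones_def scalar_prod_def)
  moreover have "N (?J * ?J) \<le> N ?J * N ?J" "N (real n \<cdot>\<^sub>m ?J) = real n * N ?J"
    using N by (auto simp: matrix_norm_def all_ones_def)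
  ultimately have *: "real n * N ?J \<le> N ?J * N ?J" by simp
  have "?J $$ (0, 0) \<noteq> 0\<^sub>m n n $$ (0, 0)" using n by (simp add: all_ones_def)
  then have "?J \<noteq> 0\<^sub>m n n" by metis
  then have "N ?J \<noteq> 0" "N ?J \<ge> 0" using N by (auto simp: matrix_norm_def all_ones_def)
  then have "real n \<le> N ?J" using * by simp
  then show ?thesis using n by linarith
qed

lemma sum_dobrushin_step_le:
  assumes N: "matrix_norm N" and n: "n \<ge> 1" and R: "R \<in> carrier_mat n n" and \<mu>: "N R \<le> \<mu>"
  shows "(\<Sum>i<n. (dobrushin_step n R ^^ t) (\<lambda>_. 1) i) \<le> (1 - (1 - \<mu>) / real n) ^ t * N (all_ones n)"
proof -
  let ?J = "all_ones n"
  define v where "v t = (dobrushin_step n R ^^ t) (\<lambda>_. 1)" for t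
  \<comment> \<open>\<open>A t\<close> is the \<open>t\<close>-th power of the step matrix applied to the all-ones matrix; all its columns
    equal \<open>v t\<close>.\<close>
  define A where "A t = Matrix.mat n n (\<lambda>(i, j). v t i)" for t
  define r where "r = 1 - (1 - \<mu>) / real n"
  have r: "r = (1 - 1 / real n) + 1 / real n * \<mu>" by (simp add: r_def diff_divide_distrib)
  have nonneg: "N B \<ge> 0" for B using N by (simp add: matrix_norm_def)
  have triangle: "N (B + C) \<le> N B + N C" if "dim_row B = dim_row C" "dim_col B = dim_col C" for B C
    using N that by (simp add: matrix_norm_def)
  have \<mu>0: "0 \<le> \<mu>" using nonneg[of R] \<mu> by linarith
  have r0: "0 \<le> r" unfolding r using n \<mu>0 by (simp add: field_simps)
  have bound: "N (A t) \<le> r ^ t * N ?J" for t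
  proof (induction t)
    case 0
    have "A 0 = ?J" by (rule eq_matI) (auto simp: A_def v_def all_ones_def)
    then show ?case by simp
  next
    case (Suc t)
    have "A (Suc t) = (1 - 1 / real n) \<cdot>\<^sub>m A t + (1 / real n) \<cdot>\<^sub>m (R * A t)"
      by (rule eq_matI) (use R in \<open>auto simp: A_def v_def dobrushin_step_def scalar_prod_def
          lessThan_atLeast0 intro!: sum.cong\<close>)
    also have "N \<dots> \<le> N ((1 - 1 / real n) \<cdot>\<^sub>m A t) + N ((1 / real n) \<cdot>\<^sub>m (R * A t))"
      by (rule triangle) (use R in \<open>auto simp: A_def\<close>)
    also have "\<dots> = (1 - 1 / real n) * N (A t) + 1 / real n * N (R * A t)"
      using N n by (auto simp: matrix_norm_def)
    also have "N (R * A t) \<le> N R * N (A t)"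
      using N R by (auto simp: matrix_norm_def A_def)
    also have "\<dots> \<le> \<mu> * N (A t)" by (intro mult_right_mono \<mu> nonneg)
    finally have "N (A (Suc t)) \<le> r * N (A t)"
      by (simp add: r algebra_simps divide_right_mono)
    also have "\<dots> \<le> r * (r ^ t * N ?J)" by (intro mult_left_mono Suc.IH r0)
    finally show ?case by simp
  qed
  let ?s = "\<Sum>i<n. v t i"
  have "?J * A t = ?s \<cdot>\<^sub>m ?J"
    by (rule eq_matI) (auto simp: A_def all_ones_def scalar_prod_def lessThan_atLeast0)
  moreover have "N (?J * A t) \<le> N ?J * N (A t)"
    using N by (auto simp: matrix_norm_def A_def all_ones_def)
  ultimately have "\<bar>?s\<bar> * N ?J \<le> N ?J * N (A t)"
    using N by (simp add: matrix_norm_def)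
  then have "\<bar>?s\<bar> \<le> N (A t)" using matrix_norm_all_ones_ge[OF N n] by (simp add: mult.commute)
  then show ?thesis using bound[of t] by (simp add: r_def v_def)
qed


section \<open>The mixing time\<close>

lemma (in spin_system) mixing_time_le:
  assumes n: "n \<ge> 1" and R: "dependency_matrix n q P R" and N: "matrix_norm N"
    and \<mu>: "N R \<le> \<mu>" "\<mu> < 1" and \<epsilon>: "0 < \<epsilon>"
    and t: "real n * inverse (1 - \<mu>) * ln (N (all_ones n) / \<epsilon>) \<le> real t"
  shows "mixing_time (configs n q) \<pi> (random_update n P) \<epsilon> \<le> enat t"
proof -
  let ?J = "N (all_ones n)" and ?a = "(1 - \<mu>) / real n"
  have J: "1 \<le> ?J" by (rule matrix_norm_all_ones_ge[OF N n])
  have \<mu>0: "0 \<le> \<mu>" using N \<mu>(1) unfolding matrix_norm_def by (meson order_trans)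
  have "?a \<le> 1" using n \<mu>0 by simp
  then have "(1 - ?a) ^ t \<le> exp (- ?a) ^ t"
    using exp_ge_add_one_self[of "- ?a"] by (intro power_mono) auto
  also have "\<dots> = exp (- (?a * real t))" by (simp add: mult.commute flip: exp_of_nat_mult)
  also have "\<dots> \<le> exp (- ln (?J / \<epsilon>))"
    using t n \<mu>(2) by (simp add: field_simps)
  also have "\<dots> = \<epsilon> / ?J" using J \<epsilon> by (simp add: exp_minus)
  finally have *: "(1 - ?a) ^ t * ?J \<le> \<epsilon>" using J by (simp add: field_simps)
  have "R \<in> carrier_mat n n" using R by (simp add: dependency_matrix_def)
  from sum_dobrushin_step_le[OF N n this \<mu>(1), of t] *
  have "d_TV (configs n q) (pmf (state_dist (random_update n P) x t)) (pmf \<pi>) \<le> \<epsilon>"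
    if "x \<in> configs n q" for x
    using d_TV_state_dist_le[OF n R that, of t] by linarith
  then show ?thesis unfolding mixing_time_def by (intro INF_lower) auto
qed

theorem lemma1:
  fixes q :: "nat \<Rightarrow> nat"
    and \<pi> :: "nat \<Rightarrow> config pmf"
    and P :: "nat \<Rightarrow> nat \<Rightarrow> config \<Rightarrow> config pmf"
    and R :: "nat \<Rightarrow> real mat"
    and N :: "nat \<Rightarrow> real mat \<Rightarrow> real"
    and \<mu> :: "nat \<Rightarrow> real"
    and \<epsilon> :: real
  assumes "0 < \<epsilon>" and "\<epsilon> < 1"
    and "\<And>n. n \<ge> 1 \<Longrightarrow> spin_system n (q n) (\<pi> n) (P n)"
    and "\<And>n. n \<ge> 1 \<Longrightarrow> dependency_matrix n (q n) (P n) (R n)"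
    and "\<And>n. n \<ge> 1 \<Longrightarrow> matrix_norm (N n)"
    and "\<And>n. n \<ge> 1 \<Longrightarrow> N n (R n) \<le> \<mu> n"
    and "\<And>n. n \<ge> 1 \<Longrightarrow> \<mu> n < 1"
  shows "limsup (\<lambda>n.
      ereal_of_enat (mixing_time (configs n (q n)) (\<pi> n) (random_update n (P n)) \<epsilon>) /
      ereal (real n * inverse (1 - \<mu> n) * ln (inverse (1 - \<mu> n) * N n (all_ones n) / \<epsilon>))) \<le> 1"
    (is "limsup ?ratio \<le> 1")
proof -
  define L where "L = ln (1 / \<epsilon>)"
  have L: "L > 0" using assms(1,2) by (simp add: L_def)
  have bound: "?ratio n \<le> ereal (1 + 1 / (real n * L))" if n: "n \<ge> 1" for n
  proof -
    define J where "J = N n (all_ones n)"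
    define b where "b = inverse (1 - \<mu> n)"
    define T where "T = real n * b * ln (J / \<epsilon>)"
    define D where "D = real n * b * ln (b * J / \<epsilon>)"
    define \<tau> where "\<tau> = mixing_time (configs n (q n)) (\<pi> n) (random_update n (P n)) \<epsilon>"
    have J: "1 \<le> J" unfolding J_def by (rule matrix_norm_all_ones_ge[OF assms(5)[OF n] n])
    have "0 \<le> \<mu> n" using assms(5,6)[OF n] unfolding matrix_norm_def by (meson order_trans)
    then have b: "1 \<le> b" using assms(7)[OF n] by (simp add: b_def one_le_inverse)
    have "J / \<epsilon> \<le> b * J / \<epsilon>" using b J assms(1) by (simp add: divide_right_mono)
    then have lnJ: "ln (J / \<epsilon>) \<le> ln (b * J / \<epsilon>)" using J assms(1) by (simp add: ln_mono)
    have LJ: "L \<le> ln (J / \<epsilon>)" unfolding L_def using J assms(1)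
      by (intro ln_mono) (auto simp: divide_right_mono)
    have TD: "T \<le> D" unfolding T_def D_def using b lnJ by (intro mult_left_mono) auto
    have "real n * L \<le> real n * b * ln (J / \<epsilon>)"
      using b LJ L by (intro mult_mono) (auto simp: mult_le_cancel_left1)
    then have nL: "real n * L \<le> D" using TD by (simp add: T_def)
    have nL0: "0 < real n * L" using n L by simp
    have "\<tau> \<le> enat (nat \<lceil>T\<rceil>)"
      unfolding \<tau>_def
      by (rule spin_system.mixing_time_le[OF assms(3)[OF n] n assms(4)[OF n] assms(5)[OF n]
            assms(6)[OF n] assms(7)[OF n] assms(1)])
        (simp add: T_def J_def b_def real_nat_ceiling_ge)
    then obtain k where k: "\<tau> = enat k" "k \<le> nat \<lceil>T\<rceil>" by (cases \<tau>) auto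
    have "0 \<le> T" unfolding T_def using b LJ L by simp
    then have "real k \<le> D + 1" using k(2) TD by linarith
    then have "real k / D \<le> 1 + 1 / D"
      using nL nL0 by (simp add: field_simps)
    also have "\<dots> \<le> 1 + 1 / (real n * L)" using nL nL0 by (simp add: frac_le)
    finally have "ereal_of_enat \<tau> / ereal D \<le> ereal (1 + 1 / (real n * L))"
      using nL nL0 by (simp add: k(1))
    then show ?thesis by (simp add: \<tau>_def D_def b_def J_def)
  qed
  have "limsup ?ratio \<le> limsup (\<lambda>n. ereal (1 + 1 / (real n * L)))"
    by (rule Limsup_mono) (use bound in \<open>auto intro: eventually_sequentiallyI[of 1]\<close>)
  also have "\<dots> = 1"
  proof (rule lim_imp_Limsup)
    have "(\<lambda>n. 1 + (1 / L) * inverse (real n)) \<longlonglongrightarrow> 1 + (1 / L) * 0"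
      by (intro tendsto_intros lim_inverse_n)
    then show "(\<lambda>n. ereal (1 + 1 / (real n * L))) \<longlonglongrightarrow> 1"
      by (simp add: one_ereal_def field_simps)
  qed simp
  finally show ?thesis .
qed

end
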